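(* Let $\{(x^k,z^k,y^k)\}_{k\in\mathbb N}$ be a sequence generated by FLAG (described in the context) and suppose that $\sigma=0$. Then, for any optimal solution $x^*$ of problem (P) and every integer $N\ge 1$, $$\Psi(x^N)-\Psi(x^* )\le\frac{B_{\rho,c}(x^* )}{2N},\qquad \|\mathcal A x^N-b\|\le\frac{B_{\rho,c}(x^* )}{cN},$$ where $B_{\rho,c}(x^* ):=2\left(\|x^*-z^0\|_P^2+\frac{1}{\mu\rho}(\|y^0\|+c)^2\right)$.
   Context: **Problem.** Let $\Psi:\mathbb R^n\to(-\infty,+\infty]$ be proper, lower semicontinuous and $\sigma$-strongly convex with $\sigma\ge 0$ ($\sigma=0$ means merely convex), $\mathcal A:\mathbb R^n\to\mathbb R^m$ linear, $b\in\mathbb R^m$. Problem (P) is $\min\{\Psi(x):\mathcal A x=b,\ x\in\mathbb R^n\}$, with feasible set $\mathcal F=\{x\in\mathbb R^n:\mathcal A x=b\}$. The Lagrangian is $\mathcal L(x,y)=\Psi(x)+\langle y,\mathcal A x-b\rangle$ and, for $\rho\geq 0$, the augmented Lagrangian is $\mathcal L_\rho(x,y)=\mathcal L(x,y)+\frac{\rho}{2}\|\mathcal A x-b\|^2$. Standing assumption: $\mathcal L$ has a saddle point, i.e. there is $(x^*,y^* )$ with $\mathcal L(x^*,y)\le\mathcal L(x^*,y^* )\le\mathcal L(x,y^* )$ for all $x\in\mathbb R^n,y\in\mathbb R^m$. The dual problem is to maximize $\inf_x\mathcal L(x,y)$ over $y\in\mathbb R^m$. The constant $c>0$ is such that $c\ge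 2\|y^*\|$, where $y^*$ is an optimal solution of the dual problem. **Notation.** $\mathbb S_+^n$ is the set of $n\times n$ symmetric positive semidefinite matrices; for $P\in\mathbb S_+^n$, $\|u\|_P=\sqrt{\langle u,Pu\rangle}$ and $\Delta_P(u,v,w)=\frac12(\|u-v\|_P^2-\|u-w\|_P^2)$. **Nice primal algorithmic map.** Given $\rho,t>0$, let $\rho_t=\rho,\tau_t=1$ if $\sigma=0$, and $\rho_t=\rho t,\tau_t=t$ if $\sigma>0$. A (possibly set-valued) map $\mathrm{Prim}_t$ on $\mathbb R^n\times\mathbb R^m$ with values in $\mathbb R^n$ is nice with $\delta\in(0,1]$ and $P,Q\in\mathbb S_+^n$ if for all $(z,\lambda)$, all $z^+\in\mathrm{Prim}_t(z,\lambda)$ and all $\xi\in\mathcal F$, $$\mathcal L_{\rho_t}(z^+,\lambda)-\mathcal L_{\rho_t}(\xi,\lambda)\le\tau_t\Delta_P(\xi,z,z^+)-\frac{\tau_t}{2}\|z^+-z\|_Q^2-\frac{\sigma}{2}\|\xi-z^+\|^2-\frac{\delta\rho_t}{2}\|\mathcal A z^+-b\|^2.$$ **FLAG.** Put $p=1$ if $\sigma=0$ and $p=2$ if $\sigma>0$. Input: maps $\mathrm{Prim}_{t_k}$ that are nice with the same $\delta,P,Q$ for all $k$. Choose $\mu\in(0,\delta]$, $\rho>0$, any $(x^0,z^0,y^0)\in\mathbb R^n\times\mathbb R^n\times\mathbb R^m$, $t_0=1$. For $k\ge0$ let $\rho_k=\rho t_k^{p-1}$ (so $\rho_k=\rho$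 if $\sigma=0$, $\rho_k=\rho t_k$ if $\sigma>0$) and $$\lambda^k=y^k+\rho_k(t_k-1)(\mathcal A x^k-b),\quad z^{k+1}\in\mathrm{Prim}_{t_k}(z^k,\lambda^k),\quad y^{k+1}=y^k+\mu\rho_k(\mathcal A z^{k+1}-b),\quad x^{k+1}=(1-t_k^{-1})x^k+t_k^{-1}z^{k+1},$$ and $t_{k+1}=t_k+1$ if $p=1$, $t_{k+1}=(1+\sqrt{1+4t_k^2})/2$ if $p=2$. *)

theory Defs
  imports "HOL-Analysis.Analysis"
begin

section \<open>The convex problem and its Lagrangians\<close>

definition proper :: "('a \<Rightarrow> ereal) \<Rightarrow> bool" where
  "proper f \<longleftrightarrow> (\<forall>x. f x \<noteq> -\<infinity>) \<and> (\<exists>x. f x \<noteq> \<infinity>)"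

definition lsc :: "('a::topological_space \<Rightarrow> ereal) \<Rightarrow> bool" where
  "lsc f \<longleftrightarrow> (\<forall>x. f x \<le> Liminf (at x) f)"

text \<open>For functions that never take the value \<open>-\<infinity>\<close>; \<open>\<sigma> = 0\<close> is plain convexity.\<close>

definition strongly_convex :: "real \<Rightarrow> ('a::real_normed_vector \<Rightarrow> ereal) \<Rightarrow> bool" where
  "strongly_convex \<sigma> f \<longleftrightarrow>
     (\<forall>x y \<theta>. 0 < \<theta> \<and> \<theta> < 1 \<longrightarrow>
        f (\<theta> *\<^sub>R x + (1 - \<theta>) *\<^sub>R y)
          \<le> ereal \<theta> * f x + ereal (1 - \<theta>) * f y
             - ereal (\<sigma> / 2 * \<theta> * (1 - \<theta>) * (norm (x - y))\<^sup>2))"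

definition feasible_set :: "(real^'n \<Rightarrow> real^'m) \<Rightarrow> real^'m \<Rightarrow> (real^'n) set" where
  "feasible_set A b = {x. A x = b}"

definition primal_optimal ::
  "(real^'n \<Rightarrow> ereal) \<Rightarrow> (real^'n \<Rightarrow> real^'m) \<Rightarrow> real^'m \<Rightarrow> real^'n \<Rightarrow> bool" where
  "primal_optimal \<Psi> A b x \<longleftrightarrow>
     x \<in> feasible_set A b \<and> (\<forall>u\<in>feasible_set A b. \<Psi> x \<le> \<Psi> u)"

definition lagrangian ::
  "(real^'n \<Rightarrow> ereal) \<Rightarrow> (real^'n \<Rightarrow> real^'m) \<Rightarrow> real^'m \<Rightarrow> real^'n \<Rightarrow> real^'m \<Rightarrow> ereal" where
  "lagrangian \<Psi> A b x y = \<Psi> x + ereal (y \<bullet> (A x - b))"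

definition aug_lagrangian ::
  "(real^'n \<Rightarrow> ereal) \<Rightarrow> (real^'n \<Rightarrow> real^'m) \<Rightarrow> real^'m \<Rightarrow> real \<Rightarrow> real^'n \<Rightarrow> real^'m \<Rightarrow> ereal" where
  "aug_lagrangian \<Psi> A b \<rho> x y =
     lagrangian \<Psi> A b x y + ereal (\<rho> / 2 * (norm (A x - b))\<^sup>2)"

definition saddle_point ::
  "('a \<Rightarrow> 'b \<Rightarrow> ereal) \<Rightarrow> 'a \<Rightarrow> 'b \<Rightarrow> bool" where
  "saddle_point L xs ys \<longleftrightarrow> (\<forall>x y. L xs y \<le> L xs ys \<and> L xs ys \<le> L x ys)"

definition dual_optimal ::
  "(real^'n \<Rightarrow> ereal) \<Rightarrow> (real^'n \<Rightarrow> real^'m) \<Rightarrow> real^'m \<Rightarrow> real^'m \<Rightarrow> bool" where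
  "dual_optimal \<Psi> A b ys \<longleftrightarrow>
     (\<forall>y. (INF x. lagrangian \<Psi> A b x y) \<le> (INF x. lagrangian \<Psi> A b x ys))"

section \<open>Nice primal algorithmic maps\<close>

definition psd :: "real^'n^'n \<Rightarrow> bool" where
  "psd P \<longleftrightarrow> transpose P = P \<and> (\<forall>u. 0 \<le> u \<bullet> (P *v u))"

definition pnorm :: "real^'n^'n \<Rightarrow> real^'n \<Rightarrow> real" where
  "pnorm P u = sqrt (u \<bullet> (P *v u))"

definition Delta :: "real^'n^'n \<Rightarrow> real^'n \<Rightarrow> real^'n \<Rightarrow> real^'n \<Rightarrow> real" where
  "Delta P u v w = 1 / 2 * ((pnorm P (u - v))\<^sup>2 - (pnorm P (u - w))\<^sup>2)"

definition rho_t :: "real \<Rightarrow> real \<Rightarrow> real \<Rightarrow> real" where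
  "rho_t \<sigma> \<rho> t = (if \<sigma> = 0 then \<rho> else \<rho> * t)"

definition tau_t :: "real \<Rightarrow> real \<Rightarrow> real" where
  "tau_t \<sigma> t = (if \<sigma> = 0 then 1 else t)"

text \<open>The difference below is a subtraction in \<^typ>\<open>ereal\<close>, where \<open>\<infinity> - \<infinity> = \<infinity>\<close>. If \<open>\<Psi>\<close> is proper
  and finite at some feasible point, then the inequality at that point forces \<open>\<Psi> zp < \<infinity>\<close>; so
  \<open>\<infinity> - \<infinity>\<close> does not arise, and the inequality is vacuous for feasible \<open>\<xi>\<close> with \<open>\<Psi> \<xi> = \<infinity>\<close>.\<close>

definition nice_primal_map ::
  "(real^'n \<Rightarrow> ereal) \<Rightarrow> real \<Rightarrow> (real^'n \<Rightarrow> real^'m) \<Rightarrow> real^'m \<Rightarrow> real \<Rightarrow> real \<Rightarrow>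
   real \<Rightarrow> real^'n^'n \<Rightarrow> real^'n^'n \<Rightarrow> (real^'n \<Rightarrow> real^'m \<Rightarrow> (real^'n) set) \<Rightarrow> bool" where
  "nice_primal_map \<Psi> \<sigma> A b \<rho> t \<delta> P Q Prim \<longleftrightarrow>
     0 < \<delta> \<and> \<delta> \<le> 1 \<and> psd P \<and> psd Q \<and>
     (\<forall>z lam. \<forall>zp\<in>Prim z lam. \<forall>\<xi>\<in>feasible_set A b.
        aug_lagrangian \<Psi> A b (rho_t \<sigma> \<rho> t) zp lam - aug_lagrangian \<Psi> A b (rho_t \<sigma> \<rho> t) \<xi> lam
          \<le> ereal (tau_t \<sigma> t * Delta P \<xi> z zp
                   - tau_t \<sigma> t / 2 * (pnorm Q (zp - z))\<^sup>2
                   - \<sigma> / 2 * (norm (\<xi> - zp))\<^sup>2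
                   - \<delta> * rho_t \<sigma> \<rho> t / 2 * (norm (A zp - b))\<^sup>2))"

section \<open>FLAG\<close>

definition flag_p :: "real \<Rightarrow> nat" where
  "flag_p \<sigma> = (if \<sigma> = 0 then 1 else 2)"

primrec flag_t :: "real \<Rightarrow> nat \<Rightarrow> real" where
  "flag_t \<sigma> 0 = 1"
| "flag_t \<sigma> (Suc k) =
     (if flag_p \<sigma> = 1 then flag_t \<sigma> k + 1 else (1 + sqrt (1 + 4 * (flag_t \<sigma> k)\<^sup>2)) / 2)"

definition flag_rho :: "real \<Rightarrow> real \<Rightarrow> nat \<Rightarrow> real" where
  "flag_rho \<sigma> \<rho> k = \<rho> * flag_t \<sigma> k ^ (flag_p \<sigma> - 1)"

text \<open>\<open>Prim t\<close> is the set-valued primal map for the parameter \<open>t\<close>; the starting point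
  \<open>(x 0, z 0, y 0)\<close> is arbitrary.\<close>

definition flag_sequence ::
  "real \<Rightarrow> (real^'n \<Rightarrow> real^'m) \<Rightarrow> real^'m \<Rightarrow> real \<Rightarrow> real \<Rightarrow>
   (real \<Rightarrow> real^'n \<Rightarrow> real^'m \<Rightarrow> (real^'n) set) \<Rightarrow>
   (nat \<Rightarrow> real^'n) \<Rightarrow> (nat \<Rightarrow> real^'n) \<Rightarrow> (nat \<Rightarrow> real^'m) \<Rightarrow> bool" where
  "flag_sequence \<sigma> A b \<rho> \<mu> Prim x z y \<longleftrightarrow>
     (\<forall>k. let t = flag_t \<sigma> k; r = flag_rho \<sigma> \<rho> k;
              lam = y k + (r * (t - 1)) *\<^sub>R (A (x k) - b)
          in z (Suc k) \<in> Prim t (z k) lam \<and>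
             y (Suc k) = y k + (\<mu> * r) *\<^sub>R (A (z (Suc k)) - b) \<and>
             x (Suc k) = (1 - inverse t) *\<^sub>R x k + inverse t *\<^sub>R z (Suc k))"

definition flag_B ::
  "real^'n^'n \<Rightarrow> real \<Rightarrow> real \<Rightarrow> real \<Rightarrow> real^'n \<Rightarrow> real^'m \<Rightarrow> real^'n \<Rightarrow> real" where
  "flag_B P \<mu> \<rho> c z0 y0 xs =
     2 * ((pnorm P (xs - z0))\<^sup>2 + 1 / (\<mu> * \<rho>) * (norm y0 + c)\<^sup>2)"

end

theory Submission
  imports Defs
begin

text \<open>
  When \<open>\<sigma> = 0\<close>, the step parameter is \<open>t\<^sub>k = k + 1\<close>. FLAG is then an averaging scheme: for
  \<open>N \<ge> 1\<close> the iterate \<open>x\<^sup>N\<close> is the mean of \<open>z\<^sup>1, \<dots>, z\<^sup>N\<close>, so that Jensen's inequality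
  bounds \<open>N (\<Psi> (x\<^sup>N) - \<Psi> (x\<^sup>*))\<close> by the sum of the gaps at the \<open>z\<^sup>i\<close>, and \<open>N (A x\<^sup>N - b)\<close> is the sum
  \<open>R\<^sub>N\<close> of the residuals \<open>u\<^sub>i = A z\<^sup>i\<^sup>+\<^sup>1 - b\<close>, \<open>i < N\<close>. Both multipliers are functions of this sum,
  \<open>y\<^sup>k = y\<^sup>0 + \<mu>\<rho> R\<^sub>k\<close> and \<open>\<lambda>\<^sup>k = y\<^sup>k + \<rho> R\<^sub>k\<close>.

  Niceness at \<open>\<xi> = x\<^sup>*\<close> bounds \<open>\<Psi> (z\<^sup>k\<^sup>+\<^sup>1) - \<Psi> (x\<^sup>*) + \<langle>\<lambda>\<^sup>k, u\<^sub>k\<rangle>\<close> by a telescoping difference minus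
  \<open>(1 + \<delta>) \<rho> / 2\<close> times \<open>\<parallel>u\<^sub>k\<parallel>\<^sup>2\<close>. For an arbitrary multiplier \<open>y\<close>, two completions of squares make
  \<open>\<langle>y - \<lambda>\<^sup>k, u\<^sub>k\<rangle>\<close> telescope as well: the part \<open>\<rho> \<langle>R\<^sub>k, u\<^sub>k\<rangle>\<close> uses up the weight \<open>\<rho> / 2\<close> of the negative
  term, and the part \<open>\<langle>y - y\<^sup>k, u\<^sub>k\<rangle>\<close> uses up \<open>\<mu> \<rho> / 2 \<le> \<delta> \<rho> / 2\<close>. Summation
  (\<open>multiplier_telescoping\<close>) gives, for every \<open>y\<close>,
  \<open>N (\<Psi> (x\<^sup>N) - \<Psi> (x\<^sup>*)) + N \<langle>y, A x\<^sup>N - b\<rangle> \<le> \<parallel>x\<^sup>* - z\<^sup>0\<parallel>\<^sub>P\<^sup>2 / 2 + \<parallel>y - y\<^sup>0\<parallel>\<^sup>2 / (2\<mu>\<rho>)\<close>.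

  With \<open>y\<close> of norm \<open>c\<close> along \<open>A x\<^sup>N - b\<close>, the gap plus \<open>c \<parallel>A x\<^sup>N - b\<parallel>\<close> is at most \<open>B / (4 N)\<close>, which
  contains the first claim. The gap can be negative, but strong duality
  (\<open>dual_optimal_attains_primal_value\<close>) keeps it above \<open>- \<parallel>y\<^sup>*\<parallel> \<parallel>A x\<^sup>N - b\<parallel> \<ge> - (c / 2) \<parallel>A x\<^sup>N - b\<parallel>\<close>.
  Hence \<open>(c / 2) \<parallel>A x\<^sup>N - b\<parallel> \<le> B / (4 N)\<close>, which is the second claim.
\<close>

section \<open>Strong duality from a saddle point\<close>

text \<open>Since \<open>L(x, \<cdot>)\<close> is affine with slope \<open>A x - b\<close>, it has a maximum only if \<open>x\<close> is feasible; moving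
  the multiplier one step along the residual already contradicts maximality otherwise.\<close>

lemma saddle_point_feasible_finite:
  fixes \<Psi> :: "real^'n \<Rightarrow> ereal" and A :: "real^'n \<Rightarrow> real^'m"
  assumes "proper \<Psi>" and "saddle_point (lagrangian \<Psi> A b) xs ys"
  shows "A xs = b" and "\<bar>\<Psi> xs\<bar> \<noteq> \<infinity>"
proof -
  have le: "lagrangian \<Psi> A b xs v \<le> lagrangian \<Psi> A b xs ys"
    and ge: "lagrangian \<Psi> A b xs ys \<le> lagrangian \<Psi> A b u ys" for u v
    using assms(2) unfolding saddle_point_def by auto
  obtain u where u: "\<Psi> u \<noteq> \<infinity>"
    using assms(1) unfolding proper_def by blast
  have "\<Psi> xs \<noteq> \<infinity>"
    using ge[of u] u by (cases "\<Psi> u") (auto simp: lagrangian_def)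
  then show fin: "\<bar>\<Psi> xs\<bar> \<noteq> \<infinity>"
    using assms(1) unfolding proper_def by auto
  then obtain p where p: "\<Psi> xs = ereal p"
    by (cases "\<Psi> xs") auto
  have "(ys + (A xs - b)) \<bullet> (A xs - b) \<le> ys \<bullet> (A xs - b)"
    using le[of "ys + (A xs - b)"] by (simp add: lagrangian_def p)
  then have "(A xs - b) \<bullet> (A xs - b) \<le> 0"
    by (simp add: inner_add_left)
  then show "A xs = b"
    by (metis eq_iff_diff_eq_0 inner_eq_zero_iff inner_ge_zero order_antisym)
qed

lemma dual_optimal_attains_primal_value:
  fixes \<Psi> :: "real^'n \<Rightarrow> ereal" and A :: "real^'n \<Rightarrow> real^'m"
  assumes "proper \<Psi>" and "saddle_point (lagrangian \<Psi> A b) xs ys"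
    and "dual_optimal \<Psi> A b ystar" and "primal_optimal \<Psi> A b xstar"
  shows "\<bar>\<Psi> xstar\<bar> \<noteq> \<infinity>" and "\<Psi> xstar \<le> lagrangian \<Psi> A b u ystar"
proof -
  note xs = saddle_point_feasible_finite[OF assms(1,2)]
  have opt: "\<Psi> xstar \<le> \<Psi> xs"
    using assms(4) xs(1) unfolding primal_optimal_def feasible_set_def by blast
  then show "\<bar>\<Psi> xstar\<bar> \<noteq> \<infinity>"
    using xs(2) assms(1) unfolding proper_def by auto
  have "\<Psi> xs = lagrangian \<Psi> A b xs ys"
    by (simp add: lagrangian_def xs(1))
  also have "\<dots> \<le> (INF v. lagrangian \<Psi> A b v ys)"
    using assms(2) unfolding saddle_point_def by (auto intro: INF_greatest)
  also have "\<dots> \<le> (INF v. lagrangian \<Psi> A b v ystar)"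
    using assms(3) unfolding dual_optimal_def by blast
  also have "\<dots> \<le> lagrangian \<Psi> A b u ystar"
    by (rule INF_lower) simp
  finally show "\<Psi> xstar \<le> lagrangian \<Psi> A b u ystar"
    using opt by (rule order_trans[rotated])
qed

section \<open>Telescoping the multiplier terms\<close>

text \<open>The vector \<open>y0 + (\<mu> + 1) \<rho> R\<^sub>k\<close> is FLAG's \<open>\<lambda>\<^sup>k = y\<^sup>k + \<rho> R\<^sub>k\<close>, because \<open>y\<^sup>k = y0 + \<mu>\<rho> R\<^sub>k\<close>. Each
  of the two parts produces a square, of \<open>R\<^sub>k\<close> and of \<open>y - y\<^sup>k\<close>; keeping both squares on the left makes
  the inequality strong enough to be preserved by a step.\<close>

lemma multiplier_telescoping_invariant:
  fixes u :: "nat \<Rightarrow> 'a::real_inner" and w d :: "nat \<Rightarrow> real"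
  defines "R \<equiv> \<lambda>k. \<Sum>i<k. u i"
  assumes "\<rho> > 0" and "0 < \<mu>" and "\<mu> \<le> \<delta>"
    and step: "\<And>k. w k + (y0 + ((\<mu> + 1) * \<rho>) *\<^sub>R R k) \<bullet> u k
                \<le> d k - d (Suc k) - (1 + \<delta>) * \<rho> / 2 * (norm (u k))\<^sup>2"
  shows "(\<Sum>k<N. w k) + y \<bullet> R N + \<rho> / 2 * (norm (R N))\<^sup>2 + d N
           + (norm (y - (y0 + (\<mu> * \<rho>) *\<^sub>R R N)))\<^sup>2 / (2 * (\<mu> * \<rho>))
         \<le> d 0 + (norm (y - y0))\<^sup>2 / (2 * (\<mu> * \<rho>))"
proof (induction N)
  case 0
  then show ?case by (simp add: R_def)
next
  case (Suc N)
  define m where "m = \<mu> * \<rho>"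
  have m: "m > 0" using assms by (simp add: m_def)
  define a where "a = y - (y0 + m *\<^sub>R R N)"
  have R: "R (Suc N) = R N + u N" by (simp add: R_def)
  have a: "y - (y0 + m *\<^sub>R R (Suc N)) = a - m *\<^sub>R u N"
    by (simp add: a_def R algebra_simps)
  have sqa: "(norm (a - m *\<^sub>R u N))\<^sup>2 / (2 * m)
               = (norm a)\<^sup>2 / (2 * m) - a \<bullet> u N + m / 2 * (norm (u N))\<^sup>2"
  proof -
    have "(norm (a - m *\<^sub>R u N))\<^sup>2 = (norm a)\<^sup>2 - 2 * m * (a \<bullet> u N) + m\<^sup>2 * (norm (u N))\<^sup>2"
      unfolding power2_norm_eq_inner inner_diff_left inner_diff_right power2_eq_square[of m]
      by (simp add: inner_commute algebra_simps)
    then show ?thesis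
      using m by (simp add: add_divide_distrib diff_divide_distrib power2_eq_square)
  qed
  have sqR: "(norm (R (Suc N)))\<^sup>2 = (norm (R N))\<^sup>2 + 2 * (R N \<bullet> u N) + (norm (u N))\<^sup>2"
    by (simp add: R power2_norm_eq_inner inner_add_left inner_add_right inner_commute)
  have lam: "(y0 + ((\<mu> + 1) * \<rho>) *\<^sub>R R N) \<bullet> u N = y \<bullet> u N - a \<bullet> u N + \<rho> * (R N \<bullet> u N)"
    by (simp add: a_def m_def inner_diff_left inner_add_left algebra_simps)
  have "m * (norm (u N))\<^sup>2 \<le> \<delta> * \<rho> * (norm (u N))\<^sup>2"
    using assms by (intro mult_right_mono) (auto simp: m_def)
  then show ?case
    using Suc.IH step[of N]
    unfolding m_def[symmetric] a sqa sqR lam a_def[symmetric]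
    by (simp add: R inner_add_right algebra_simps add_divide_distrib)
qed

lemma multiplier_telescoping:
  fixes u :: "nat \<Rightarrow> 'a::real_inner" and w d :: "nat \<Rightarrow> real"
  defines "R \<equiv> \<lambda>k. \<Sum>i<k. u i"
  assumes "\<rho> > 0" and "0 < \<mu>" and "\<mu> \<le> \<delta>" and "\<And>k. 0 \<le> d k"
    and "\<And>k. w k + (y0 + ((\<mu> + 1) * \<rho>) *\<^sub>R R k) \<bullet> u k
                \<le> d k - d (Suc k) - (1 + \<delta>) * \<rho> / 2 * (norm (u k))\<^sup>2"
  shows "(\<Sum>k<N. w k) + y \<bullet> R N \<le> d 0 + (norm (y - y0))\<^sup>2 / (2 * (\<mu> * \<rho>))"
proof -
  have "0 \<le> \<rho> / 2 * (norm (R N))\<^sup>2"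
    and "0 \<le> (norm (y - (y0 + (\<mu> * \<rho>) *\<^sub>R R N)))\<^sup>2 / (2 * (\<mu> * \<rho>))"
    using assms by simp_all
  then show ?thesis
    using multiplier_telescoping_invariant[OF assms(2-4), where u = u and w = w and d = d
        and ?y0.0 = y0 and y = y and N = N] assms(5)[of N] assms(6)
    unfolding R_def by fastforce
qed

text \<open>Testing against the multiplier of norm \<open>c\<close> along \<open>r\<close> replaces the inner product by the norm.\<close>

lemma inner_bound_imp_norm_bound:
  fixes r y0 :: "'a::real_inner"
  assumes "0 \<le> c" and "0 \<le> q"
    and "\<And>y. g + y \<bullet> r \<le> D + q * (norm (y - y0))\<^sup>2"
  shows "g + c * norm r \<le> D + q * (norm y0 + c)\<^sup>2"
proof -
  have "norm (c *\<^sub>R sgn r) \<le> c"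
    using assms(1) by (simp add: norm_sgn)
  then have "norm (c *\<^sub>R sgn r - y0) \<le> norm y0 + c"
    using norm_triangle_ineq4[of "c *\<^sub>R sgn r" y0] by linarith
  then have "q * (norm (c *\<^sub>R sgn r - y0))\<^sup>2 \<le> q * (norm y0 + c)\<^sup>2"
    using assms(2) by (intro mult_left_mono power_mono) auto
  moreover have "(c *\<^sub>R sgn r) \<bullet> r = c * norm r"
    by (cases "r = 0") (auto simp: sgn_div_norm dot_square_norm power2_eq_square)
  ultimately show ?thesis
    using assms(3)[of "c *\<^sub>R sgn r"] by linarith
qed

section \<open>FLAG without strong convexity\<close>

lemma flag_t_zero: "flag_t 0 k = real k + 1"
  by (induction k) (simp_all add: flag_p_def)

lemma flag_sequence_zeroD:
  assumes "flag_sequence 0 A b \<rho> \<mu> Prim x z y"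
  shows "z (Suc k) \<in> Prim (flag_t 0 k) (z k) (y k + (\<rho> * real k) *\<^sub>R (A (x k) - b))"
    and "y (Suc k) = y k + (\<mu> * \<rho>) *\<^sub>R (A (z (Suc k)) - b)"
    and "x (Suc k) = (real k / real (Suc k)) *\<^sub>R x k + (1 / real (Suc k)) *\<^sub>R z (Suc k)"
proof -
  have "1 - inverse (real k + 1) = real k / real (Suc k)"
    by (simp add: field_simps)
  then show "z (Suc k) \<in> Prim (flag_t 0 k) (z k) (y k + (\<rho> * real k) *\<^sub>R (A (x k) - b))"
    and "y (Suc k) = y k + (\<mu> * \<rho>) *\<^sub>R (A (z (Suc k)) - b)"
    and "x (Suc k) = (real k / real (Suc k)) *\<^sub>R x k + (1 / real (Suc k)) *\<^sub>R z (Suc k)"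
    using assms[unfolded flag_sequence_def, rule_format, of k]
    by (auto simp: Let_def flag_t_zero flag_rho_def flag_p_def inverse_eq_divide add.commute)
qed

text \<open>Multiplying the averaging step by \<open>k + 1\<close> makes it additive: \<open>(k + 1) x\<^sup>k\<^sup>+\<^sup>1 = k x\<^sup>k + z\<^sup>k\<^sup>+\<^sup>1\<close>.\<close>

lemma flag_residual_sum:
  fixes A :: "real^'n \<Rightarrow> real^'m"
  assumes "linear A" and "flag_sequence 0 A b \<rho> \<mu> Prim x z y"
  shows "real k *\<^sub>R (A (x k) - b) = (\<Sum>i<k. A (z (Suc i)) - b)"
proof (induction k)
  case 0
  then show ?case by simp
next
  case (Suc k)
  have "real (Suc k) *\<^sub>R x (Suc k) = real k *\<^sub>R x k + z (Suc k)"
    by (simp add: flag_sequence_zeroD(3)[OF assms(2)] scaleR_right_distrib del: of_nat_Suc)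
  from arg_cong[OF this, of A]
  have "real (Suc k) *\<^sub>R A (x (Suc k)) = real k *\<^sub>R A (x k) + A (z (Suc k))"
    by (simp add: linear_add[OF assms(1)] linear_scale[OF assms(1)] del: of_nat_Suc)
  then have "real (Suc k) *\<^sub>R (A (x (Suc k)) - b)
               = real k *\<^sub>R (A (x k) - b) + (A (z (Suc k)) - b)"
    by (simp add: algebra_simps)
  then show ?case using Suc.IH by simp
qed

lemma flag_multiplier_sum:
  fixes A :: "real^'n \<Rightarrow> real^'m"
  assumes "flag_sequence 0 A b \<rho> \<mu> Prim x z y"
  shows "y k = y 0 + (\<mu> * \<rho>) *\<^sub>R (\<Sum>i<k. A (z (Suc i)) - b)"
  by (induction k) (simp_all add: flag_sequence_zeroD(2)[OF assms] scaleR_right_distrib)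

text \<open>The first iterate is \<open>z\<^sup>1\<close> itself. Starting there keeps \<open>\<Psi> (x\<^sup>0)\<close>, which may be infinite, out of
  Jensen's inequality.\<close>

lemma flag_jensen:
  fixes A :: "real^'n \<Rightarrow> real^'m"
  assumes "strongly_convex 0 \<Psi>" and "flag_sequence 0 A b \<rho> \<mu> Prim x z y"
    and w: "\<And>k. \<Psi> (z (Suc k)) = ereal (w k)" and "N \<ge> 1"
  shows "\<Psi> (x N) \<le> ereal ((\<Sum>k<N. w k) / real N)"
  using \<open>N \<ge> 1\<close>
proof (induction N rule: dec_induct)
  case base
  show ?case
    using flag_sequence_zeroD(3)[OF assms(2), of 0] w[of 0] by simp
next
  case (step k)
  define \<theta> where "\<theta> = real k / real (Suc k)"
  have \<theta>: "0 < \<theta>" "\<theta> < 1" "1 - \<theta> = 1 / real (Suc k)"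
    using step.hyps by (auto simp: \<theta>_def field_simps)
  have "\<Psi> (x (Suc k)) \<le> ereal \<theta> * \<Psi> (x k) + ereal (1 - \<theta>) * \<Psi> (z (Suc k))"
    using assms(1)[unfolded strongly_convex_def, rule_format, of \<theta> "x k" "z (Suc k)"] \<theta>
    by (simp add: flag_sequence_zeroD(3)[OF assms(2)] \<theta>_def[symmetric] zero_ereal_def[symmetric]
        del: of_nat_Suc)
  also have "\<dots> \<le> ereal \<theta> * ereal ((\<Sum>i<k. w i) / real k) + ereal (1 - \<theta>) * \<Psi> (z (Suc k))"
    using step.IH \<theta> by (intro add_right_mono ereal_mult_left_mono) auto
  also have "\<dots> = ereal ((\<Sum>i<Suc k. w i) / real (Suc k))"
    using step.hyps unfolding w \<theta>(3) by (simp add: \<theta>_def add_divide_distrib)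
  finally show ?case .
qed

text \<open>Besides the estimate this yields finiteness of \<open>\<Psi>\<close> at the new point: the right-hand side of
  the niceness inequality is a real number, and so is the subtracted value at \<open>x\<^sup>*\<close>. The penalty at
  \<open>z\<^sup>+\<close> contributes the \<open>1\<close> in \<open>1 + \<delta>\<close>.\<close>

lemma nice_primal_map_estimate:
  fixes \<Psi> :: "real^'n \<Rightarrow> ereal" and A :: "real^'n \<Rightarrow> real^'m"
  assumes "proper \<Psi>" and nice: "nice_primal_map \<Psi> 0 A b \<rho> t \<delta> P Q Prm"
    and "zp \<in> Prm z lam" and \<xi>: "\<xi> \<in> feasible_set A b" and v: "\<Psi> \<xi> = ereal v"
  obtains w where "\<Psi> zp = ereal w"
    and "w - v + lam \<bullet> (A zp - b)
           \<le> (pnorm P (\<xi> - z))\<^sup>2 / 2 - (pnorm P (\<xi> - zp))\<^sup>2 / 2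
              - (1 + \<delta>) * \<rho> / 2 * (norm (A zp - b))\<^sup>2"
proof -
  have \<xi>': "A \<xi> = b" using \<xi> by (simp add: feasible_set_def)
  have *: "\<Psi> zp + ereal (lam \<bullet> (A zp - b)) + ereal (\<rho> / 2 * (norm (A zp - b))\<^sup>2) - ereal v
          \<le> ereal (Delta P \<xi> z zp - 1 / 2 * (pnorm Q (zp - z))\<^sup>2
                   - \<delta> * \<rho> / 2 * (norm (A zp - b))\<^sup>2)"
    using nice[unfolded nice_primal_map_def] assms(3) \<xi>
    by (force simp: aug_lagrangian_def lagrangian_def \<xi>' v rho_t_def tau_t_def)
  have "\<Psi> zp \<noteq> \<infinity>" "\<Psi> zp \<noteq> -\<infinity>"
    using * assms(1) unfolding proper_def by auto
  then obtain w where w: "\<Psi> zp = ereal w"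
    by (cases "\<Psi> zp") auto
  have "w + lam \<bullet> (A zp - b) + \<rho> / 2 * (norm (A zp - b))\<^sup>2 - v
          \<le> Delta P \<xi> z zp - 1 / 2 * (pnorm Q (zp - z))\<^sup>2 - \<delta> * \<rho> / 2 * (norm (A zp - b))\<^sup>2"
    using * by (simp add: w)
  moreover have "0 \<le> 1 / 2 * (pnorm Q (zp - z))\<^sup>2" by simp
  moreover have "(1 + \<delta>) * \<rho> / 2 * (norm (A zp - b))\<^sup>2
      = \<rho> / 2 * (norm (A zp - b))\<^sup>2 + \<delta> * \<rho> / 2 * (norm (A zp - b))\<^sup>2"
    by (simp add: algebra_simps add_divide_distrib)
  ultimately have "w - v + lam \<bullet> (A zp - b)
           \<le> (pnorm P (\<xi> - z))\<^sup>2 / 2 - (pnorm P (\<xi> - zp))\<^sup>2 / 2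
              - (1 + \<delta>) * \<rho> / 2 * (norm (A zp - b))\<^sup>2"
    unfolding Delta_def by argo
  with w show ?thesis by (rule that)
qed

text \<open>The bound holds for all multipliers \<open>ym\<close> at once, so that \<open>ym\<close> can be chosen after the run,
  in the direction of the residual of \<open>x\<^sup>N\<close>.\<close>

lemma flag_lagrangian_gap:
  fixes \<Psi> :: "real^'n \<Rightarrow> ereal" and A :: "real^'n \<Rightarrow> real^'m"
  assumes "proper \<Psi>" and "strongly_convex 0 \<Psi>" and "linear A"
    and nice: "\<And>k. nice_primal_map \<Psi> 0 A b \<rho> (flag_t 0 k) \<delta> P Q (Prim (flag_t 0 k))"
    and "0 < \<mu>" and "\<mu> \<le> \<delta>" and "\<rho> > 0"
    and seq: "flag_sequence 0 A b \<rho> \<mu> Prim x z y"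
    and "\<xi> \<in> feasible_set A b" and v: "\<Psi> \<xi> = ereal v" and "N \<ge> 1"
  obtains p where "\<Psi> (x N) = ereal p"
    and "\<And>ym. real N * (p - v) + ym \<bullet> (real N *\<^sub>R (A (x N) - b))
           \<le> (pnorm P (\<xi> - z 0))\<^sup>2 / 2 + 1 / (2 * (\<mu> * \<rho>)) * (norm (ym - y 0))\<^sup>2"
proof -
  define u where "u i = A (z (Suc i)) - b" for i
  define d where "d k = (pnorm P (\<xi> - z k))\<^sup>2 / 2" for k
  have lam: "y k + (\<rho> * real k) *\<^sub>R (A (x k) - b) = y 0 + ((\<mu> + 1) * \<rho>) *\<^sub>R (\<Sum>i<k. u i)" for k
  proof -
    have "(\<rho> * real k) *\<^sub>R (A (x k) - b) = \<rho> *\<^sub>R (\<Sum>i<k. u i)"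
      using flag_residual_sum[OF assms(3) seq, of k] unfolding u_def by (metis scaleR_scaleR)
    then show ?thesis
      using flag_multiplier_sum[OF seq, of k] unfolding u_def[symmetric]
      by (simp add: scaleR_left_distrib distrib_right)
  qed
  have "\<exists>w. \<Psi> (z (Suc k)) = ereal w \<and>
          w - v + (y 0 + ((\<mu> + 1) * \<rho>) *\<^sub>R (\<Sum>i<k. u i)) \<bullet> u k
            \<le> d k - d (Suc k) - (1 + \<delta>) * \<rho> / 2 * (norm (u k))\<^sup>2" for k
    using nice_primal_map_estimate[OF assms(1) nice[of k] flag_sequence_zeroD(1)[OF seq, of k]
        assms(9) v]
    unfolding lam u_def[symmetric] d_def by metis
  then obtain w where w: "\<And>k. \<Psi> (z (Suc k)) = ereal (w k)"
    and step: "\<And>k. w k - v + (y 0 + ((\<mu> + 1) * \<rho>) *\<^sub>R (\<Sum>i<k. u i)) \<bullet> u k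
            \<le> d k - d (Suc k) - (1 + \<delta>) * \<rho> / 2 * (norm (u k))\<^sup>2"
    by metis
  have jensen: "\<Psi> (x N) \<le> ereal ((\<Sum>k<N. w k) / real N)"
    using flag_jensen[OF assms(2) seq w \<open>N \<ge> 1\<close>] .
  then obtain p where p: "\<Psi> (x N) = ereal p"
    using assms(1) unfolding proper_def by (cases "\<Psi> (x N)") auto
  have gap: "real N * (p - v) \<le> (\<Sum>k<N. w k - v)"
    using jensen \<open>N \<ge> 1\<close> by (simp add: p sum_subtractf field_simps)
  have "real N * (p - v) + ym \<bullet> (real N *\<^sub>R (A (x N) - b))
          \<le> (pnorm P (\<xi> - z 0))\<^sup>2 / 2 + 1 / (2 * (\<mu> * \<rho>)) * (norm (ym - y 0))\<^sup>2" for ym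
  proof -
    have "(\<Sum>k<N. w k - v) + ym \<bullet> (\<Sum>i<N. u i)
            \<le> d 0 + (norm (ym - y 0))\<^sup>2 / (2 * (\<mu> * \<rho>))"
      by (rule multiplier_telescoping[OF assms(7,5,6) _ step]) (simp add: d_def)
    then show ?thesis
      using gap unfolding flag_residual_sum[OF assms(3) seq] u_def[symmetric] d_def by simp
  qed
  with p show ?thesis by (rule that)
qed

section \<open>Convergence rate\<close>

theorem theorem4p2:
  fixes \<Psi> :: "real^'n \<Rightarrow> ereal"
    and A :: "real^'n \<Rightarrow> real^'m"
    and b :: "real^'m"
    and \<sigma> \<rho> \<mu> \<delta> c :: real
    and P Q :: "real^'n^'n"
    and Prim :: "real \<Rightarrow> real^'n \<Rightarrow> real^'m \<Rightarrow> (real^'n) set"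
    and x z :: "nat \<Rightarrow> real^'n"
    and y :: "nat \<Rightarrow> real^'m"
    and xstar :: "real^'n"
    and ystar :: "real^'m"
    and N :: nat
  assumes "proper \<Psi>" and "lsc \<Psi>" and "strongly_convex \<sigma> \<Psi>"
    and "linear A"
    and "\<exists>xs ys. saddle_point (lagrangian \<Psi> A b) xs ys"
    and "dual_optimal \<Psi> A b ystar" and "c > 0" and "c \<ge> 2 * norm ystar"
    and "\<And>k. nice_primal_map \<Psi> \<sigma> A b \<rho> (flag_t \<sigma> k) \<delta> P Q (Prim (flag_t \<sigma> k))"
    and "0 < \<mu>" and "\<mu> \<le> \<delta>" and "\<rho> > 0"
    and "flag_sequence \<sigma> A b \<rho> \<mu> Prim x z y"
    and "\<sigma> = 0"
    and "primal_optimal \<Psi> A b xstar"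
    and "N \<ge> 1"
  shows "\<Psi> (x N) - \<Psi> xstar \<le> ereal (flag_B P \<mu> \<rho> c (z 0) (y 0) xstar / (2 * real N))
       \<and> norm (A (x N) - b) \<le> flag_B P \<mu> \<rho> c (z 0) (y 0) xstar / (c * real N)"
proof -
  have \<sigma>: "\<sigma> = 0" by fact
  obtain xs ys where saddle: "saddle_point (lagrangian \<Psi> A b) xs ys"
    using assms(5) by blast
  note dual = dual_optimal_attains_primal_value[OF assms(1) saddle assms(6,15)]
  obtain v where v: "\<Psi> xstar = ereal v"
    using dual(1) by (cases "\<Psi> xstar") auto
  have feas: "xstar \<in> feasible_set A b"
    using assms(15) by (simp add: primal_optimal_def)
  define B where "B = flag_B P \<mu> \<rho> c (z 0) (y 0) xstar"
  define r where "r = A (x N) - b"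
  have N: "real N > 0" using assms(16) by simp
  have \<mu>\<rho>: "\<mu> * \<rho> > 0" using assms(10,12) by simp
  obtain p where p: "\<Psi> (x N) = ereal p"
    and gap: "\<And>ym. real N * (p - v) + ym \<bullet> (real N *\<^sub>R r)
           \<le> (pnorm P (xstar - z 0))\<^sup>2 / 2 + 1 / (2 * (\<mu> * \<rho>)) * (norm (ym - y 0))\<^sup>2"
    using flag_lagrangian_gap[OF assms(1) assms(3)[unfolded \<sigma>] assms(4) assms(9)[unfolded \<sigma>]
        assms(10-12) assms(13)[unfolded \<sigma>] feas v assms(16)]
    unfolding r_def by metis
  have "real N * (p - v) + c * norm (real N *\<^sub>R r)
          \<le> (pnorm P (xstar - z 0))\<^sup>2 / 2 + 1 / (2 * (\<mu> * \<rho>)) * (norm (y 0) + c)\<^sup>2"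
    using assms(7) \<mu>\<rho> gap by (intro inner_bound_imp_norm_bound) auto
  also have "\<dots> = B / 4"
    by (simp add: B_def flag_B_def field_simps)
  finally have main: "real N * (p - v + c * norm r) \<le> B / 4"
    using N by (simp add: algebra_simps)
  have B: "0 \<le> B"
    using \<mu>\<rho> by (simp add: B_def flag_B_def)
  have "real N * (c * norm r) \<ge> 0"
    using assms(7) by simp
  then have "real N * (p - v) \<le> B / 2"
    using main B by (simp add: distrib_left)
  then have primal: "p - v \<le> B / (2 * real N)"
    using N by (simp add: field_simps)
  have "v \<le> p + ystar \<bullet> r"
    using dual(2)[of "x N"] by (simp add: v p lagrangian_def r_def)
  moreover have "ystar \<bullet> r \<le> c / 2 * norm r"
    using norm_cauchy_schwarz[of ystar r] assms(8) mult_right_mono[of "norm ystar" "c / 2" "norm r"]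
    by simp
  ultimately have "c / 2 * norm r \<le> p - v + c * norm r"
    by simp
  then have "real N * (c / 2 * norm r) \<le> B / 4"
    using main N by (meson mult_left_mono order_less_imp_le order_trans)
  then have "real N * (c * norm r) \<le> B"
    using B by argo
  then have "norm r \<le> B / (c * real N)"
    using N assms(7) by (simp add: pos_le_divide_eq mult_ac)
  with primal show ?thesis
    by (simp add: p v B_def r_def)
qed

end
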